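(* For every integer $n\ge 2$, let $\pi$ be a uniformly random permutation in $S_n$, and let $M_n=\mathrm{pk}(\pi)+1$ and $M'_n=\mathrm{pk}(\pi^{-1})+1$. Then \[ \mathrm{Cov}(M_n,M'_n)=\frac{n-2}{3n(n-1)}. \]
   Context: Let $S_n$ be the symmetric group of permutations of $\{1,\dots,n\}$. A permutation $\pi\in S_n$ has a peak at position $i$, where $2\le i\le n-1$, if $\pi(i-1)<\pi(i)>\pi(i+1)$. Let $\mathrm{pk}(\pi)$ denote the number of peaks of $\pi$. $\mathrm{Cov}$ denotes covariance with respect to the uniform distribution on $S_n$. *)

theory Defs
  imports "HOL-Probability.Probability" "HOL-Combinatorics.Permutations"
begin

definition peaks :: "nat \<Rightarrow> (nat \<Rightarrow> nat) \<Rightarrow> nat set" where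
  "peaks n p = {i. 2 \<le> i \<and> i \<le> n - 1 \<and> p (i - 1) < p i \<and> p i > p (i + 1)}"

definition pk :: "nat \<Rightarrow> (nat \<Rightarrow> nat) \<Rightarrow> nat" where
  "pk n p = card (peaks n p)"

definition uniform_perm :: "nat \<Rightarrow> (nat \<Rightarrow> nat) pmf" where
  "uniform_perm n = pmf_of_set {p. p permutes {1..n}}"

definition covariance :: "'a measure \<Rightarrow> ('a \<Rightarrow> real) \<Rightarrow> ('a \<Rightarrow> real) \<Rightarrow> real" where
  "covariance M X Y =
     (\<integral>x. (X x - (\<integral>y. X y \<partial>M)) * (Y x - (\<integral>y. Y y \<partial>M)) \<partial>M)"

end

theory Submission
  imports Defs
begin

text \<open>
  A peak of \<open>p\<close> at position \<open>i\<close> concerns only the three positions around \<open>i\<close>, and a peak of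
  \<open>inv p\<close> at \<open>j\<close> only the three values around \<open>j\<close>. Write \<open>A = {a..a + 2}\<close> and
  \<open>B = {b..b + 2}\<close> for these two windows, \<open>X\<close> for the event that \<open>p\<close> has its peak in the middle
  of \<open>A\<close> and \<open>Y\<close> for the event that \<open>inv p\<close> has its peak in the middle of \<open>B\<close>. Each of them has
  probability \<open>1/3\<close>, and the covariance of the two peak numbers is the sum of the covariances of
  \<open>X\<close> and \<open>Y\<close> over all \<open>(n - 2)\<^sup>2\<close> pairs of windows.

  The point is that \<open>X\<close> and \<open>Y\<close> are uncorrelated unless \<open>p\<close> maps \<open>A\<close> exactly onto \<open>B\<close>. Rotating the
  positions in \<open>A\<close> cyclically and, independently, the values in \<open>B\<close> cyclically is an action of a
  group of order \<open>9\<close> on the permutations, and it preserves the condition \<open>p ` A = B\<close>. If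
  \<open>p ` A \<noteq> B\<close>, then exactly one of the nine rotated versions of \<open>p\<close> satisfies both \<open>X\<close> and \<open>Y\<close>
  (\<open>ex1_peaks_after_rot\<close>), so among these permutations a fraction of precisely \<open>1/9\<close> does. Most of
  the time this is because rotating the values does not change where the maximum on \<open>A\<close> is: then
  \<open>X\<close> fixes the rotation of the positions, and given that rotation, \<open>Y\<close> fixes the rotation of the
  values. The same works with the roles of \<open>p\<close> and \<open>inv p\<close> exchanged. In the remaining case two
  elements of \<open>A\<close> are mapped into \<open>B\<close>, the third one has a value below \<open>B\<close> and the third value in
  \<open>B\<close> sits before \<open>A\<close>; there the uniqueness comes out of evaluating the nine rotations.

  If \<open>p ` A = B\<close>, then \<open>X\<close> and \<open>Y\<close> force \<open>p\<close> to be \<open>b, b + 2, b + 1\<close> on \<open>A\<close>. So \<open>(n - 3)!\<close> of the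
  \<open>6 (n - 3)!\<close> permutations of this kind satisfy both events, a fraction of \<open>1/6\<close>. In total
  \<open>9 |X \<and> Y| = (n! - 6 (n - 3)!) + 9 (n - 3)! = n! + 3 (n - 3)!\<close> (\<open>card_two_peaks\<close>), which gives the
  covariance \<open>(n - 3)! / (3 n!)\<close> for each pair of windows.
\<close>

section \<open>Counting permutations\<close>

text \<open>
  Double counting of the pairs \<open>(g, x)\<close> with \<open>P (act g x)\<close>: the hypothesis gives one \<open>g\<close> for each
  \<open>x\<close>, while for fixed \<open>g\<close> the bijection \<open>act g\<close> identifies the possible \<open>x\<close> with the elements
  satisfying \<open>P\<close>. Uniqueness of a suitable symmetry \<open>g\<close> thus determines the probability of \<open>P\<close>.
\<close>

lemma card_eq_card_mult_if_ex1:
  assumes "finite G" "finite S"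
    and act: "\<And>g. g \<in> G \<Longrightarrow> bij_betw (act g) S S"
    and ex1: "\<And>x. x \<in> S \<Longrightarrow> \<exists>!g. g \<in> G \<and> P (act g x)"
  shows "card S = card G * card {x \<in> S. P x}"
proof -
  have same: "card {x \<in> S. P (act g x)} = card {x \<in> S. P x}" if "g \<in> G" for g
  proof (rule bij_betw_same_card)
    show "bij_betw (act g) {x \<in> S. P (act g x)} {x \<in> S. P x}"
      using act[OF that] unfolding bij_betw_def inj_on_def by auto
  qed
  have "S = (\<Union>g\<in>G. {x \<in> S. P (act g x)})"
    using ex1 by blast
  also have "card \<dots> = (\<Sum>g\<in>G. card {x \<in> S. P (act g x)})"
    using assms(1,2) ex1 by (intro card_UN_disjoint) auto
  also have "\<dots> = card G * card {x \<in> S. P x}"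
    using same by simp
  finally show ?thesis .
qed

lemma permutes_extension_exists:
  assumes "finite S" "A \<subseteq> S" "inj_on f A" "f ` A \<subseteq> S"
  obtains q where "q permutes S" "\<And>x. x \<in> A \<Longrightarrow> q x = f x"
proof -
  have "card (S - A) = card (S - f ` A)"
    using assms by (simp add: card_Diff_subset finite_subset card_image)
  then obtain g where g: "bij_betw g (S - A) (S - f ` A)"
    using finite_same_card_bij[OF finite_Diff[OF assms(1)] finite_Diff[OF assms(1)]] by auto
  define q where "q x = (if x \<in> A then f x else if x \<in> S then g x else x)" for x
  have "bij_betw q A (f ` A)"
    using assms(3) by (auto simp: q_def bij_betw_def inj_on_def)
  moreover have "bij_betw q (S - A) (S - f ` A)"
    using g by (rule bij_betw_cong[THEN iffD1, rotated]) (simp add: q_def)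
  ultimately have "bij_betw q (A \<union> (S - A)) (f ` A \<union> (S - f ` A))"
    by (rule bij_betw_combine) auto
  then have "bij_betw q S S"
    using assms by (simp add: Un_absorb1)
  then have "q permutes S"
    using assms(2) by (intro bij_imp_permutes) (auto simp: q_def)
  then show ?thesis
    using that by (simp add: q_def)
qed

text \<open>
  Composing with the inverse of one extension of \<open>f\<close> turns the permutations that agree with \<open>f\<close>
  on \<open>A\<close> into those that fix \<open>A\<close> pointwise.
\<close>

lemma card_permutations_prescribed:
  assumes "finite S" "A \<subseteq> S" "inj_on f A" "f ` A \<subseteq> S"
  shows "card {p. p permutes S \<and> (\<forall>x\<in>A. p x = f x)} = fact (card S - card A)"
proof -
  obtain q where q: "q permutes S" "\<And>x. x \<in> A \<Longrightarrow> q x = f x"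
    using permutes_extension_exists[OF assms] by blast
  have "bij_betw (\<lambda>r. q \<circ> r) {r. r permutes (S - A)} {p. p permutes S \<and> (\<forall>x\<in>A. p x = f x)}"
  proof (rule bij_betw_byWitness[where f' = "\<lambda>p. inv q \<circ> p"])
    show "\<forall>r\<in>{r. r permutes (S - A)}. inv q \<circ> (q \<circ> r) = r"
      using q(1) by (simp add: comp_assoc[symmetric] permutes_inv_o)
    show "\<forall>p\<in>{p. p permutes S \<and> (\<forall>x\<in>A. p x = f x)}. q \<circ> (inv q \<circ> p) = p"
      using q(1) by (simp add: comp_assoc[symmetric] permutes_inv_o)
    show "(\<lambda>r. q \<circ> r) ` {r. r permutes (S - A)} \<subseteq> {p. p permutes S \<and> (\<forall>x\<in>A. p x = f x)}"
    proof clarify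
      fix r assume r: "r permutes (S - A)"
      have "r permutes S" using r by (rule permutes_subset) auto
      then have "(q \<circ> r) permutes S" using q(1) by (rule permutes_compose)
      moreover have "(q \<circ> r) x = f x" if "x \<in> A" for x
        using r that q(2) by (simp add: permutes_not_in)
      ultimately show "(q \<circ> r) permutes S \<and> (\<forall>x\<in>A. (q \<circ> r) x = f x)" by blast
    qed
    show "(\<lambda>p. inv q \<circ> p) ` {p. p permutes S \<and> (\<forall>x\<in>A. p x = f x)} \<subseteq> {r. r permutes (S - A)}"
    proof clarify
      fix p assume p: "p permutes S" "\<forall>x\<in>A. p x = f x"
      have "(inv q \<circ> p) permutes S"
        using p(1) q(1) by (intro permutes_compose permutes_inv)
      moreover have "(inv q \<circ> p) x = x" if "x \<in> A" for x
        using p(2) q that by (metis comp_apply permutes_inverses(2))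
      ultimately show "(inv q \<circ> p) permutes (S - A)"
        by (rule permutes_superset) auto
    qed
  qed
  then have "card {p. p permutes S \<and> (\<forall>x\<in>A. p x = f x)} = card {r. r permutes (S - A)}"
    by (simp add: bij_betw_same_card)
  also have "\<dots> = fact (card S - card A)"
    using assms by (intro card_permutations) (auto simp: card_Diff_subset finite_subset)
  finally show ?thesis .
qed

lemma bij_betw_permutation_comp:
  assumes "t permutes S" "s permutes S"
  shows "bij_betw (\<lambda>p. t \<circ> p \<circ> s) {p. p permutes S} {p. p permutes S}"
proof (rule bij_betw_byWitness[where f' = "\<lambda>p. inv t \<circ> p \<circ> inv s"])
  show "\<forall>p\<in>{p. p permutes S}. inv t \<circ> (t \<circ> p \<circ> s) \<circ> inv s = p"
       "\<forall>p\<in>{p. p permutes S}. t \<circ> (inv t \<circ> p \<circ> inv s) \<circ> s = p"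
    using assms by (auto simp: fun_eq_iff permutes_inverses)
qed (use assms in \<open>auto intro!: permutes_compose permutes_inv\<close>)

text \<open>
  Fix a bijection \<open>f\<close> from \<open>A\<close> to \<open>B\<close>. Each \<open>p\<close> with \<open>p ` A = B\<close> becomes an extension of \<open>f\<close> after
  precomposition with exactly one permutation of \<open>A\<close>.
\<close>

lemma card_permutations_image_eq:
  assumes S: "finite S" and A: "A \<subseteq> S" and B: "B \<subseteq> S" and AB: "card A = card B"
  shows "card {p. p permutes S \<and> p ` A = B} = fact (card A) * fact (card S - card A)"
proof -
  have fin: "finite A" "finite B" using S A B finite_subset by auto
  then obtain f where f: "bij_betw f A B"
    using finite_same_card_bij[OF fin AB] by auto
  then have inj: "inj_on f A" and im: "f ` A = B" by (auto simp: bij_betw_def)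
  let ?S = "{p. p permutes S \<and> p ` A = B}"
  let ?P = "\<lambda>p. \<forall>x\<in>A. p x = f x"
  have "card ?S = card {s. s permutes A} * card {p \<in> ?S. ?P p}"
  proof (rule card_eq_card_mult_if_ex1[where act = "\<lambda>s p. p \<circ> s"])
    show "finite {s. s permutes A}" using fin by (simp add: finite_permutations)
    show "finite ?S" using S by (simp add: finite_permutations)
  next
    fix s assume "s \<in> {s. s permutes A}"
    then have s: "s permutes A" "s permutes S" using A permutes_subset by auto
    have "bij_betw (\<lambda>p. id \<circ> p \<circ> s) {p. p permutes S} {p. p permutes S}"
      using s(2) by (intro bij_betw_permutation_comp permutes_id)
    moreover have "(p \<circ> s) ` A = p ` A" for p :: "'a \<Rightarrow> 'a"
      using permutes_image[OF s(1)] by (metis image_comp)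
    ultimately have "bij_betw (\<lambda>p. p \<circ> s) {p \<in> {p. p permutes S}. p ` A = B} {p \<in> {p. p permutes S}. p ` A = B}"
      by (intro bij_betw_Collect) (simp_all add: id_comp)
    then show "bij_betw (\<lambda>p. p \<circ> s) ?S ?S" by simp
  next
    fix p assume "p \<in> ?S"
    then have p: "p permutes S" "p ` A = B" by auto
    (* On A, the only candidate is the composition of f with the inverse of p. *)
  define s where "s y = (if y \<in> A then inv p (f y) else y)" for y
    have ps: "p (s y) = f y" if "y \<in> A" for y
      using that p(1) by (simp add: s_def permutes_inverses)
    have sA: "s y \<in> A" if "y \<in> A" for y
    proof -
      have "f y \<in> p ` A" using that im p(2) by auto
      then obtain x where "x \<in> A" "p x = f y" by auto
      then show ?thesis using that p(1) by (metis s_def permutes_inverses(2))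
    qed
    have "inj_on s A"
      using inj ps by (metis inj_on_def)
    then have "bij_betw s A A"
      using sA fin(1) by (simp add: bij_betw_def endo_inj_surj image_subset_iff)
    then have s: "s permutes A"
      by (rule bij_imp_permutes) (simp add: s_def)
    show "\<exists>!s. s \<in> {s. s permutes A} \<and> ?P (p \<circ> s)"
    proof (rule ex1I[of _ s])
      show "s \<in> {s. s permutes A} \<and> ?P (p \<circ> s)" using s ps by simp
    next
      fix s' assume s': "s' \<in> {s. s permutes A} \<and> ?P (p \<circ> s')"
      show "s' = s"
      proof
        fix x show "s' x = s x"
        proof (cases "x \<in> A")
          case True
          then have "p (s' x) = p (s x)" using s' ps by simp
          then show ?thesis using permutes_inj[OF p(1)] by (simp add: inj_eq)
        next
          case False
          then have "s x = x" "s' x = x"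
            using s s' permutes_not_in by (fastforce, fastforce)
          then show ?thesis by simp
        qed
      qed
    qed
  qed
  also have "{p \<in> ?S. ?P p} = {p. p permutes S \<and> ?P p}"
    using im by auto
  finally show ?thesis
    using card_permutations_prescribed[OF S A inj] card_permutations[OF refl fin(1)] im B
    by simp
qed

section \<open>Peaks and rotations of a window of length three\<close>

text \<open>
  The window of the peak is indexed by its left end \<open>a\<close>, so that the peak itself is at \<open>a + 1\<close>.
  This avoids subtraction, and \<open>a\<close> ranges over \<open>{1..n - 2}\<close>.
\<close>

definition peak_at :: "nat \<Rightarrow> (nat \<Rightarrow> nat) \<Rightarrow> bool" where
  "peak_at a p \<longleftrightarrow> p a < p (a + 1) \<and> p (a + 2) < p (a + 1)"

definition rot :: "nat \<Rightarrow> nat \<Rightarrow> nat \<Rightarrow> nat" where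
  "rot a s x = (if x \<in> {a..a + 2} then a + (x - a + s) mod 3 else x)"

lemma sum_lessThan_3: "(\<Sum>s<3. f s) = f 0 + f 1 + f 2" for f :: "nat \<Rightarrow> nat"
  by (simp add: eval_nat_numeral)

lemma ex1_pairE:
  assumes "\<exists>!(s, t). Q s t"
  obtains s t where "Q s t" "\<And>s' t'. Q s' t' \<Longrightarrow> (s', t') = (s, t)"
proof -
  from assms obtain g where g: "case g of (s, t) \<Rightarrow> Q s t"
      and only: "\<And>h. (case h of (s, t) \<Rightarrow> Q s t) \<Longrightarrow> h = g"
    by (rule ex1E) iprover
  obtain s t where st: "g = (s, t)" by (cases g)
  show thesis
  proof (rule that)
    show "Q s t" using g st by simp
    show "(s', t') = (s, t)" if "Q s' t'" for s' t'
      using only[of "(s', t')"] that st by simp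
  qed
qed

lemma ex1_pair_if_sum_eq_1:
  fixes m n :: nat
  assumes "(\<Sum>s<m. \<Sum>t<n. of_bool (Q s t)) = (1::nat)"
  shows "\<exists>!(s, t). (s, t) \<in> {..<m} \<times> {..<n} \<and> Q s t"
proof -
  let ?G = "{..<m} \<times> {..<n}"
  have "(\<Sum>s<m. \<Sum>t<n. of_bool (Q s t)) = (\<Sum>g\<in>?G. of_bool (case g of (s, t) \<Rightarrow> Q s t) :: nat)"
    unfolding sum.cartesian_product by (rule sum.cong) auto
  also have "\<dots> = card (?G \<inter> {g. case g of (s, t) \<Rightarrow> Q s t})"
    by (subst sum_of_bool_eq) simp_all
  finally have "card (?G \<inter> {g. case g of (s, t) \<Rightarrow> Q s t}) = 1"
    using assms by (simp only:)
  then obtain g where g: "?G \<inter> {g. case g of (s, t) \<Rightarrow> Q s t} = {g}"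
    by (rule card_1_singletonE)
  then have iff: "(s, t) \<in> {..<m} \<times> {..<n} \<and> Q s t \<longleftrightarrow> (s, t) = g" for s t
    by blast
  show ?thesis
    unfolding iff by (simp add: case_prod_unfold)
qed

lemma less_3_cases: "(s::nat) < 3 \<longleftrightarrow> s = 0 \<or> s = 1 \<or> s = 2"
  by auto

lemma window_eq: "{a..a + 2} = {a, a + 1, a + 2 :: nat}"
  by auto

lemma window_mem: "y \<in> {b..b + 2} \<longleftrightarrow> y = b \<or> y = Suc b \<or> y = Suc (Suc b)" for y :: nat
  by auto

lemma rot_outside: "x \<notin> {a..a + 2} \<Longrightarrow> rot a s x = x"
  by (auto simp: rot_def)

lemma rot_inside: "k < 3 \<Longrightarrow> rot a s (a + k) = a + (k + s) mod 3"
  by (auto simp: rot_def)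

lemma rot_0_3: "rot a 0 x = x" "rot a 3 x = x"
proof -
  have "rot a 0 x = x \<and> rot a 3 x = x"
  proof (cases "x \<in> {a..a + 2}")
    case True
    then obtain k where "k < 3" "x = a + k"
      by (auto simp: le_iff_add)
    then show ?thesis by (simp add: rot_inside)
  qed (simp add: rot_outside)
  then show "rot a 0 x = x" "rot a 3 x = x" by simp_all
qed

lemma rot_simps:
  "rot a (Suc 0) a = a + 1" "rot a (Suc 0) (Suc a) = a + 2" "rot a (Suc 0) (Suc (Suc a)) = a"
  "rot a 2 a = a + 2" "rot a 2 (Suc a) = a" "rot a 2 (Suc (Suc a)) = a + 1"
  "x < a \<Longrightarrow> rot a s x = x"
  by (auto simp: rot_def mod_Suc)

lemma rot_rot:
  assumes "s \<le> 3"
  shows "rot a (3 - s) (rot a s x) = x" "rot a s (rot a (3 - s) x) = x"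
proof -
  have "rot a (3 - s) (rot a s x) = x \<and> rot a s (rot a (3 - s) x) = x"
  proof (cases "x \<in> {a..a + 2}")
    case True
    then obtain k where k: "k < 3" "x = a + k"
      by (auto simp: le_iff_add)
    have "(k + s) mod 3 < 3" "(k + (3 - s)) mod 3 < 3" by simp_all
    then show ?thesis
      using k assms by (simp add: rot_inside mod_add_left_eq add.assoc del: add_diff_assoc add_diff_assoc2)
  next
    case False
    then show ?thesis by (simp add: rot_outside)
  qed
  then show "rot a (3 - s) (rot a s x) = x" "rot a s (rot a (3 - s) x) = x"
    by simp_all
qed

lemma rot_mem: "x \<in> {a..a + 2} \<Longrightarrow> rot a s x \<in> {a..a + 2}"
  by (auto simp: rot_def)

lemma rot_permutes:
  assumes "s \<le> 3" shows "rot a s permutes {a..a + 2}"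
proof (rule bij_imp_permutes)
  show "bij_betw (rot a s) {a..a + 2} {a..a + 2}"
    by (rule bij_betw_byWitness[where f' = "rot a (3 - s)"])
       (use rot_rot[OF assms] rot_mem in blast)+
qed (rule rot_outside)

lemma inv_rot:
  assumes "s \<le> 3" shows "inv (rot a s) = rot a (3 - s)"
  by (rule inv_unique_comp) (simp_all add: fun_eq_iff rot_rot[OF assms])

text \<open>
  The rotation has to carry the middle of the window to the position of the maximum.
\<close>

lemma ex1_rot_peak_at:
  assumes "inj_on f {a..a + 2}"
  shows "\<exists>!s. s < 3 \<and> peak_at a (f \<circ> rot a s)"
proof -
  have "f a \<noteq> f (a + 1)" "f a \<noteq> f (a + 2)" "f (a + 1) \<noteq> f (a + 2)"
    using assms unfolding window_eq by auto
  then consider "f a < f (a + 1)" "f (a + 2) < f (a + 1)"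
    | "f (a + 1) < f a" "f (a + 2) < f a"
    | "f (a + 1) < f (a + 2)" "f a < f (a + 2)"
    by linarith
  then show ?thesis
  proof cases
    case 1
    then show ?thesis by (intro ex1I[of _ 0]) (auto simp: peak_at_def rot_0_3 rot_simps less_3_cases)
  next
    case 2
    then show ?thesis by (intro ex1I[of _ 2]) (auto simp: peak_at_def rot_0_3 rot_simps less_3_cases)
  next
    case 3
    then show ?thesis by (intro ex1I[of _ 1]) (auto simp: peak_at_def rot_0_3 rot_simps less_3_cases)
  qed
qed

section \<open>When a permutation of the values does not move the peak\<close>

text \<open>
  A value outside an interval compares in the same way with all elements of that interval.
\<close>

lemma permutes_interval_less_iff:
  fixes x y :: nat
  assumes t: "t permutes {b..c}" and "x \<notin> {b..c} \<or> y \<notin> {b..c}"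
  shows "t x < t y \<longleftrightarrow> x < y"
proof -
  have "t x \<in> {b..c} \<longleftrightarrow> x \<in> {b..c}" "t y \<in> {b..c} \<longleftrightarrow> y \<in> {b..c}"
    using permutes_in_image[OF t] by auto
  moreover have "x \<notin> {b..c} \<Longrightarrow> t x = x" "y \<notin> {b..c} \<Longrightarrow> t y = y"
    using t by (auto simp: permutes_not_in)
  ultimately show ?thesis using assms(2)
    by (cases "x \<in> {b..c}"; cases "y \<in> {b..c}") auto
qed

text \<open>
  A condition under which permuting the values within \<open>{b..b + 2}\<close> does not move the maximum of \<open>p\<close>
  on \<open>{a..a + 2}\<close>: either the maximum exceeds all these values, or at most one of them occurs, so
  that no two values of \<open>p\<close> are exchanged with each other.
\<close>

definition inert :: "nat \<Rightarrow> nat \<Rightarrow> (nat \<Rightarrow> nat) \<Rightarrow> bool" where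
  "inert a b p \<longleftrightarrow> (\<exists>x\<in>{a..a + 2}. b + 2 < p x) \<or>
     (\<forall>x\<in>{a..a + 2}. \<forall>y\<in>{a..a + 2}. p x \<in> {b..b + 2} \<longrightarrow> p y \<in> {b..b + 2} \<longrightarrow> x = y)"

lemma peak_at_permute_values:
  assumes t: "t permutes {b..b + 2}"
    and inert: "inert a b f"
  shows "peak_at a (t \<circ> f) \<longleftrightarrow> peak_at a f"
proof -
  have less: "t x < t y \<longleftrightarrow> x < y" if "x \<notin> {b..b + 2} \<or> y \<notin> {b..b + 2}" for x y
    using permutes_interval_less_iff[OF t that] .
  from inert show ?thesis
    unfolding inert_def
  proof
    assume "\<exists>x\<in>{a..a + 2}. b + 2 < f x"
    then obtain x where x: "x \<in> {a..a + 2}" "b + 2 < f x" by blast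
    have tx: "t (f x) = f x" using x t by (simp add: permutes_not_in)
    (* If the middle value lies in the window of b, it is below the value at x before and after,
       so there is no peak at all; otherwise both comparisons are preserved. *)
    show ?thesis
    proof (cases "f (a + 1) \<in> {b..b + 2}")
      case True
      then have "t (f (a + 1)) \<in> {b..b + 2}" using permutes_in_image[OF t] by blast
      with True x tx show ?thesis
        unfolding window_eq peak_at_def comp_def by auto
    next
      case False
      then show ?thesis unfolding peak_at_def comp_def using less by blast
    qed
  next
    assume H: "\<forall>x\<in>{a..a + 2}. \<forall>y\<in>{a..a + 2}. f x \<in> {b..b + 2} \<longrightarrow> f y \<in> {b..b + 2} \<longrightarrow> x = y"
    have "f a \<notin> {b..b + 2} \<or> f (a+1) \<notin> {b..b + 2}" "f (a+2) \<notin> {b..b + 2} \<or> f (a+1) \<notin> {b..b + 2}"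
      using H[rule_format, of a "a+1"] H[rule_format, of "a+2" "a+1"] by auto
    then show ?thesis unfolding peak_at_def comp_def using less by blast
  qed
qed

lemma inert_comp_permutes:
  assumes s: "s permutes {a..a + 2}" and "inert a b f"
  shows "inert a b (f \<circ> s)"
proof -
  have im: "s x \<in> {a..a + 2} \<longleftrightarrow> x \<in> {a..a + 2}" for x
    using permutes_in_image[OF s] .
  have inj: "s x = s y \<Longrightarrow> x = y" for x y
    using permutes_inj[OF s] by (auto dest: injD)
  from assms(2) consider
      (above) x where "x \<in> {a..a + 2}" "b + 2 < f x"
    | (single) "\<forall>x\<in>{a..a + 2}. \<forall>y\<in>{a..a + 2}. f x \<in> {b..b + 2} \<longrightarrow> f y \<in> {b..b + 2} \<longrightarrow> x = y"
    unfolding inert_def by blast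
  then show ?thesis
  proof cases
    case above
    then obtain y where "y \<in> {a..a + 2}" "s y = x"
      using im permutes_surj[OF s] by (metis surjD)
    then show ?thesis
      using above unfolding inert_def comp_def by blast
  next
    case single
    then show ?thesis
      unfolding inert_def comp_def using im inj by meson
  qed
qed

section \<open>Exactly one of nine rotations has both peaks\<close>

text \<open>
  For \<open>q = inv p\<close> and \<open>s, t \<le> 3\<close>, the two functions here are mutually inverse: \<open>rot b (3 - t)\<close> is
  the inverse of \<open>rot b t\<close>. Rotating the values backwards makes the expression symmetric under
  exchanging \<open>(a, p, s)\<close> with \<open>(b, q, t)\<close>.
\<close>

definition peaks_after_rot ::
    "nat \<Rightarrow> nat \<Rightarrow> (nat \<Rightarrow> nat) \<Rightarrow> (nat \<Rightarrow> nat) \<Rightarrow> nat \<Rightarrow> nat \<Rightarrow> bool" where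
  "peaks_after_rot a b p q s t \<longleftrightarrow>
     peak_at a (rot b (3 - t) \<circ> p \<circ> rot a s) \<and> peak_at b (rot a (3 - s) \<circ> q \<circ> rot b t)"

text \<open>
  If inertness fails in both directions and \<open>p\<close> does not map one window onto the other, then exactly
  two positions \<open>x1 < x2\<close> of the first window have values in the second one; the third position \<open>x0\<close>
  has a value below the second window, and the remaining value \<open>y0\<close> of the second window has a
  position before the first one. This leaves three choices of \<open>x0\<close> and six of \<open>(y0, p x1, p x2)\<close>, and
  in each of these 18 configurations the order of the values on both windows is known under all nine
  rotations.
\<close>

lemma ex1_peaks_after_rot_if_not_inert:
  assumes pq: "\<And>x y. p x = y \<longleftrightarrow> q y = x"
    and ne: "p ` {a..a + 2} \<noteq> {b..b + 2}"
    and np: "\<not> inert a b p" and nq: "\<not> inert b a q"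
  shows "\<exists>!(s, t). (s, t) \<in> {..<3} \<times> {..<3} \<and> peaks_after_rot a b p q s t"
proof -
  have inj: "p x = p y \<longleftrightarrow> x = y" for x y using pq by metis
  have "\<not> p ` {a..a + 2} \<subseteq> {b..b + 2}"
  proof
    assume "p ` {a..a + 2} \<subseteq> {b..b + 2}"
    moreover have "card (p ` {a..a + 2}) = card {b..b + 2}"
      using inj by (simp add: card_image inj_on_def)
    ultimately show False using ne by (simp add: card_subset_eq)
  qed
  then obtain x0 where x0: "x0 \<in> {a..a + 2}" "p x0 \<notin> {b..b + 2}" by blast
  have "\<not> b + 2 < p x0" using np x0(1) unfolding inert_def by blast
  then have px0: "p x0 < b" using x0(2) by simp
  obtain x1 x2 where x12: "x1 \<in> {a..a + 2}" "x2 \<in> {a..a + 2}" "x1 < x2"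
      "p x1 \<in> {b..b + 2}" "p x2 \<in> {b..b + 2}"
    using np unfolding inert_def by (metis linorder_neqE_nat)
  have x: "(x0, x1, x2) \<in> {(a, a + 1, a + 2), (a + 1, a, a + 2), (a + 2, a, a + 1)}"
  proof -
    have "x0 \<noteq> x1" "x0 \<noteq> x2" using x0(2) x12(4,5) by auto
    then show ?thesis using x0(1) x12(1-3) by simp arith
  qed
  have "p x1 \<noteq> p x2" using x12(3) inj by simp
  with x12(4,5) have "\<exists>y0. (y0, p x1, p x2) \<in> {(b, b + 1, b + 2), (b, b + 2, b + 1), (b + 1, b, b + 2),
       (b + 1, b + 2, b), (b + 2, b, b + 1), (b + 2, b + 1, b)}"
    unfolding window_mem by (elim disjE) simp_all
  then obtain y0 where y: "(y0, p x1, p x2) \<in> {(b, b + 1, b + 2), (b, b + 2, b + 1), (b + 1, b, b + 2),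
       (b + 1, b + 2, b), (b + 2, b, b + 1), (b + 2, b + 1, b)}" ..
  then have y0: "y0 \<in> {b..b + 2}" "y0 \<noteq> p x1" "y0 \<noteq> p x2" by auto
  have "\<not> a + 2 < q y0" using nq y0(1) unfolding inert_def by blast
  moreover have "p x0 \<noteq> y0" using x0(2) y0(1) by blast
  then have "q y0 \<noteq> x0" "q y0 \<noteq> x1" "q y0 \<noteq> x2"
    using y0(2,3) by (simp_all flip: pq)
  ultimately have qy0: "q y0 < a" using x by (elim insertE emptyE; simp)
  define y1 y2 where y12: "y1 = p x1" "y2 = p x2"
  have p12: "p x1 = y1" "p x2 = y2" and q12: "q y1 = x1" "q y2 = x2"
    by (simp_all add: y12 flip: pq)
  (* Counting the rotations turns uniqueness into an equation between numerals, which the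
     simplifier settles in each configuration. *)
  define Z :: "nat \<Rightarrow> nat \<Rightarrow> nat" where "Z s t = of_bool (peaks_after_rot a b p q s t)" for s t
  have "Z 0 0 + Z 0 1 + Z 0 2 + (Z 1 0 + Z 1 1 + Z 1 2) + (Z 2 0 + Z 2 1 + Z 2 2) = 1"
    using x y[folded y12] px0 qy0 p12 q12
    by (elim insertE emptyE Pair_inject; hypsubst;
        simp add: Z_def peaks_after_rot_def peak_at_def rot_simps rot_0_3)
  then show ?thesis
    by (intro ex1_pair_if_sum_eq_1) (simp add: Z_def sum_lessThan_3)
qed

text \<open>
  By inertness, the first peak determines \<open>s\<close> independently of \<open>t\<close>. For this one \<open>s\<close>, the second
  peak determines \<open>t\<close>.
\<close>

lemma ex1_peaks_after_rot_if_inert: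
  assumes inj: "inj p" "inj q" and inert: "inert a b p"
  shows "\<exists>!(s, t). (s, t) \<in> {..<3} \<times> {..<3} \<and> peaks_after_rot a b p q s t"
proof -
  have X: "peak_at a (rot b (3 - t) \<circ> p \<circ> rot a s) \<longleftrightarrow> peak_at a (p \<circ> rot a s)" if "s < 3" for s t
  proof -
    have "inert a b (p \<circ> rot a s)"
      using that inert by (intro inert_comp_permutes rot_permutes) auto
    then show ?thesis
      using peak_at_permute_values[OF rot_permutes[of "3 - t" b]] by (simp add: comp_assoc)
  qed
  obtain s0 where s0: "s0 < 3" "peak_at a (p \<circ> rot a s0)"
      and s0_only: "\<And>s. s < 3 \<Longrightarrow> peak_at a (p \<circ> rot a s) \<Longrightarrow> s = s0"
    using ex1_rot_peak_at[of p a, OF inj_on_subset[OF inj(1) subset_UNIV]] by auto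
  have inj': "inj (rot a (3 - s0) \<circ> q)"
    using inj(2) permutes_inj[OF rot_permutes[of "3 - s0" a]] by (simp add: inj_compose)
  obtain t0 where t0: "t0 < 3" "peak_at b (rot a (3 - s0) \<circ> q \<circ> rot b t0)"
      and t0_only: "\<And>t. t < 3 \<Longrightarrow> peak_at b (rot a (3 - s0) \<circ> q \<circ> rot b t) \<Longrightarrow> t = t0"
    using ex1_rot_peak_at[of "rot a (3 - s0) \<circ> q" b, OF inj_on_subset[OF inj' subset_UNIV]] by auto
  show ?thesis
  proof (rule ex1I[of _ "(s0, t0)"])
    show "case (s0, t0) of (s, t) \<Rightarrow> (s, t) \<in> {..<3} \<times> {..<3} \<and> peaks_after_rot a b p q s t"
      using s0 t0 by (simp add: peaks_after_rot_def X)
  next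
    fix g assume g: "case g of (s, t) \<Rightarrow> (s, t) \<in> {..<3} \<times> {..<3} \<and> peaks_after_rot a b p q s t"
    obtain s t where st: "g = (s, t)" by (cases g)
    then have "s < 3" "t < 3" and peaks: "peaks_after_rot a b p q s t" using g by simp_all
    then have "s = s0" using s0_only X by (simp add: peaks_after_rot_def)
    moreover have "t = t0"
      using t0_only[OF \<open>t < 3\<close>] peaks unfolding \<open>s = s0\<close> peaks_after_rot_def by blast
    ultimately show "g = (s0, t0)" using st by simp
  qed
qed

lemma peaks_after_rot_swap: "peaks_after_rot a b p q s t \<longleftrightarrow> peaks_after_rot b a q p t s"
  by (auto simp: peaks_after_rot_def)

lemma ex1_peaks_after_rot:
  assumes pq: "\<And>x y. p x = y \<longleftrightarrow> q y = x"
    and ne: "p ` {a..a + 2} \<noteq> {b..b + 2}"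
  shows "\<exists>!(s, t). (s, t) \<in> {..<3} \<times> {..<3} \<and> peaks_after_rot a b p q s t"
proof -
  have inj: "inj p" "inj q" using pq by (metis injI)+
  consider "inert a b p" | "inert b a q" | "\<not> inert a b p" "\<not> inert b a q" by blast
  then show ?thesis
  proof cases
    case 1
    then show ?thesis using inj by (intro ex1_peaks_after_rot_if_inert)
  next
    case 2
    then have "\<exists>!(t, s). (t, s) \<in> {..<3} \<times> {..<3} \<and> peaks_after_rot b a q p t s"
      using inj by (intro ex1_peaks_after_rot_if_inert)
    then obtain t0 s0 where 0: "(t0, s0) \<in> {..<3} \<times> {..<3} \<and> peaks_after_rot b a q p t0 s0"
        and only: "\<And>t s. (t, s) \<in> {..<3} \<times> {..<3} \<and> peaks_after_rot b a q p t s \<Longrightarrow> (t, s) = (t0, s0)"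
      by (rule ex1_pairE) (rule that)
    show ?thesis
    proof (rule ex1I[of _ "(s0, t0)"])
      show "case (s0, t0) of (s, t) \<Rightarrow> (s, t) \<in> {..<3} \<times> {..<3} \<and> peaks_after_rot a b p q s t"
        using 0 by (simp add: peaks_after_rot_swap[of a])
    next
      fix g assume g: "case g of (s, t) \<Rightarrow> (s, t) \<in> {..<3} \<times> {..<3} \<and> peaks_after_rot a b p q s t"
      obtain s t where "g = (s, t)" by (cases g)
      then show "g = (s0, t0)"
        using g only[of t s] by (simp add: peaks_after_rot_swap[of a])
    qed
  next
    case 3
    then show ?thesis using pq ne by (intro ex1_peaks_after_rot_if_not_inert)
  qed
qed

lemma inv_rot_comp:
  assumes "bij p" "s \<le> 3" "t \<le> 3"
  shows "inv (rot b (3 - t) \<circ> p \<circ> rot a s) = rot a (3 - s) \<circ> inv p \<circ> rot b t"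
proof -
  have bij: "bij (rot a s)" "bij (rot b (3 - t))"
    using assms(2) rot_permutes permutes_bij by (blast, metis diff_le_self)
  show ?thesis
    using assms bij by (simp add: o_inv_distrib bij_comp inv_rot comp_assoc)
qed

section \<open>Counting permutations with two peaks\<close>

lemma card_two_peaks_window_mismatch:
  assumes a: "1 \<le> a" "a + 2 \<le> n" and b: "1 \<le> b" "b + 2 \<le> n"
  defines "S \<equiv> {p. p permutes {1..n} \<and> p ` {a..a + 2} \<noteq> {b..b + 2}}"
  shows "card S = 9 * card {p \<in> S. peak_at a p \<and> peak_at b (inv p)}"
proof -
  define G :: "(nat \<times> nat) set" where "G = {..<3} \<times> {..<3}"
  (* The values are rotated backwards, to match the convention of peaks_after_rot. *)
  define act where "act = (\<lambda>(s, t) p. rot b (3 - t) \<circ> p \<circ> rot a s)"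
  have "card S = card G * card {p \<in> S. peak_at a p \<and> peak_at b (inv p)}"
  proof (rule card_eq_card_mult_if_ex1[where act = act])
    show "finite G" by (simp add: G_def)
    show "finite S" by (simp add: S_def finite_permutations)
  next
    fix g assume "g \<in> G"
    then obtain s t where g: "g = (s, t)" "s < 3" "t < 3" by (auto simp: G_def)
    have ra: "rot a s permutes {a..a + 2}" and rb: "rot b (3 - t) permutes {b..b + 2}"
      using g rot_permutes[of s a] rot_permutes[of "3 - t" b] by simp_all
    have "rot a s permutes {1..n}" "rot b (3 - t) permutes {1..n}"
      using permutes_subset[OF ra] permutes_subset[OF rb] a b by auto
    then have bij: "bij_betw (act g) {p. p permutes {1..n}} {p. p permutes {1..n}}"
      using bij_betw_permutation_comp by (simp add: act_def g)
    have image: "act g p ` {a..a + 2} = {b..b + 2} \<longleftrightarrow> p ` {a..a + 2} = {b..b + 2}" for p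
    proof -
      have "act g p ` {a..a + 2} = rot b (3 - t) ` p ` rot a s ` {a..a + 2}"
        by (simp add: act_def g image_comp)
      also have "\<dots> = rot b (3 - t) ` p ` {a..a + 2}"
        by (simp only: permutes_image[OF ra])
      finally show ?thesis
        using permutes_image[OF rb] inj_image_eq_iff[OF permutes_inj[OF rb]] by metis
    qed
    have "S = {p \<in> {p. p permutes {1..n}}. p ` {a..a + 2} \<noteq> {b..b + 2}}"
      by (simp add: S_def)
    then show "bij_betw (act g) S S"
      using bij_betw_Collect[OF bij, of "\<lambda>p. p ` {a..a + 2} \<noteq> {b..b + 2}"
          "\<lambda>p. p ` {a..a + 2} \<noteq> {b..b + 2}", OF arg_cong[where f = Not, OF image]]
      by (simp only:)
  next
    fix p assume p: "p \<in> S"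
    then have perm: "p permutes {1..n}" by (simp add: S_def)
    have "\<exists>!(s, t). (s, t) \<in> {..<3} \<times> {..<3} \<and> peaks_after_rot a b p (inv p) s t"
      using p permutes_inv_eq[OF perm] by (intro ex1_peaks_after_rot) (auto simp: S_def)
    moreover have "peaks_after_rot a b p (inv p) s t \<longleftrightarrow> peak_at a (act (s, t) p) \<and> peak_at b (inv (act (s, t) p))"
      if "s < 3" "t < 3" for s t
      using that inv_rot_comp[OF permutes_bij[OF perm], of s t b a] by (simp add: peaks_after_rot_def act_def)
    ultimately show "\<exists>!g. g \<in> G \<and> peak_at a (act g p) \<and> peak_at b (inv (act g p))"
      unfolding G_def by (rule_tac arg_cong[where f = Ex1, THEN iffD1, rotated]) (auto simp: fun_eq_iff)
  qed
  then show ?thesis by (simp add: G_def card_cartesian_product)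
qed

text \<open>
  The first peak requires \<open>p (a + 1) = b + 2\<close>. The second one requires \<open>b\<close> to come before \<open>b + 1\<close>,
  which leaves only \<open>p a = b\<close> and \<open>p (a + 2) = b + 1\<close>.
\<close>

lemma card_two_peaks_window_match:
  assumes a: "1 \<le> a" "a + 2 \<le> n" and b: "1 \<le> b" "b + 2 \<le> n"
  shows "card {p. p permutes {1..n} \<and> p ` {a..a + 2} = {b..b + 2} \<and> peak_at a p \<and> peak_at b (inv p)}
       = fact (n - 3)"
proof -
  define f where "f x = (if x = a then b else if x = a + 1 then b + 2 else b + 1)" for x
  have f: "f a = b" "f (a + 1) = b + 2" "f (a + 2) = b + 1" by (simp_all add: f_def)
  have "p ` {a..a + 2} = {b..b + 2} \<and> peak_at a p \<and> peak_at b (inv p) \<longleftrightarrow> (\<forall>x\<in>{a..a + 2}. p x = f x)"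
    if p: "p permutes {1..n}" for p
  proof
    assume H: "p ` {a..a + 2} = {b..b + 2} \<and> peak_at a p \<and> peak_at b (inv p)"
    have inv: "inv p (p x) = x" for x using permutes_inverses(2)[OF p] .
    have "p a \<noteq> p (a + 2)" using inv[of a] inv[of "a + 2"] by auto
    moreover have "p a \<in> {b..b + 2}" "p (a + 1) \<in> {b..b + 2}" "p (a + 2) \<in> {b..b + 2}"
      using H by auto
    moreover have "p a < p (a + 1)" "p (a + 2) < p (a + 1)"
      using H by (simp_all add: peak_at_def)
    ultimately have "p (a + 1) = b + 2 \<and> (p a = b \<and> p (a + 2) = b + 1 \<or> p a = b + 1 \<and> p (a + 2) = b)"
      unfolding atLeastAtMost_iff by linarith
    (* The other arrangement would put b after b + 1. *)
    moreover have False if "p a = b + 1" "p (a + 2) = b"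
    proof -
      have "inv p (b + 1) = a" "inv p b = a + 2" using inv that by metis+
      then show False using H by (simp add: peak_at_def)
    qed
    ultimately show "\<forall>x\<in>{a..a + 2}. p x = f x"
      unfolding window_eq using f by auto
  next
    assume "\<forall>x\<in>{a..a + 2}. p x = f x"
    then have px: "p a = b" "p (a + 1) = b + 2" "p (a + 2) = b + 1"
      unfolding window_eq using f by auto
    have "inv p b = a" "inv p (b + 2) = a + 1" "inv p (b + 1) = a + 2"
      using px permutes_inverses(2)[OF p] by metis+
    with px show "p ` {a..a + 2} = {b..b + 2} \<and> peak_at a p \<and> peak_at b (inv p)"
      unfolding window_eq peak_at_def by auto
  qed
  then have "{p. p permutes {1..n} \<and> p ` {a..a + 2} = {b..b + 2} \<and> peak_at a p \<and> peak_at b (inv p)}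
           = {p. p permutes {1..n} \<and> (\<forall>x\<in>{a..a + 2}. p x = f x)}"
    by blast
  moreover have "inj_on f {a..a + 2}"
    unfolding window_eq by (auto simp: f_def)
  moreover have "f ` {a..a + 2} \<subseteq> {1..n}"
    using b by (auto simp: f_def)
  ultimately show ?thesis
    using card_permutations_prescribed[of "{1..n}" "{a..a + 2}" f] a by simp
qed

lemma card_two_peaks:
  assumes a: "1 \<le> a" "a + 2 \<le> n" and b: "1 \<le> b" "b + 2 \<le> n"
  shows "9 * card {p. p permutes {1..n} \<and> peak_at a p \<and> peak_at b (inv p)} = fact n + 3 * fact (n - 3)"
proof -
  let ?P = "{p. p permutes {1..n}}"
  let ?T = "{p. p permutes {1..n} \<and> p ` {a..a + 2} = {b..b + 2}}"
  let ?S = "{p. p permutes {1..n} \<and> p ` {a..a + 2} \<noteq> {b..b + 2}}"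
  let ?XY = "\<lambda>p. peak_at a p \<and> peak_at b (inv p)"
  have fin: "finite ?P" by (simp add: finite_permutations)
  then have finT: "finite ?T" and finS: "finite ?S" by (auto elim: finite_subset[rotated])
  have T: "card ?T = 6 * fact (n - 3)"
    using card_permutations_image_eq[of "{1..n}" "{a..a + 2}" "{b..b + 2}"] a b
    by (simp add: fact_numeral)
  have TXY: "card {p \<in> ?T. ?XY p} = fact (n - 3)"
    using card_two_peaks_window_match[OF a b] by (simp add: conj_assoc)
  have P: "card ?P = fact n" by (rule card_permutations) simp_all
  have "?P = ?T \<union> ?S" "?T \<inter> ?S = {}" by auto
  then have "card ?T + card ?S = fact n"
    using card_Un_disjoint[OF finT finS] P by metis
  moreover have "card ?S = 9 * card {p \<in> ?S. ?XY p}"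
    using card_two_peaks_window_mismatch[OF a b] .
  moreover have "card {p. p permutes {1..n} \<and> ?XY p} = card {p \<in> ?T. ?XY p} + card {p \<in> ?S. ?XY p}"
  proof -
    have split: "{p. p permutes {1..n} \<and> ?XY p} = {p \<in> ?T. ?XY p} \<union> {p \<in> ?S. ?XY p}" by auto
    show ?thesis unfolding split
      by (rule card_Un_disjoint[OF finite_subset[OF _ finT] finite_subset[OF _ finS]]) blast+
  qed
  ultimately show ?thesis
    using T TXY by linarith
qed

lemma card_peak:
  assumes "1 \<le> a" "a + 2 \<le> n"
  shows "3 * card {p. p permutes {1..n} \<and> peak_at a p} = fact n"
proof -
  let ?P = "{p. p permutes {1..n}}"
  have "card ?P = card {..<3::nat} * card {p \<in> ?P. peak_at a p}"
  proof (rule card_eq_card_mult_if_ex1[where act = "\<lambda>s p. p \<circ> rot a s"])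
    fix s :: nat assume "s \<in> {..<3}"
    then have "rot a s permutes {a..a + 2}" by (intro rot_permutes) simp
    then have "rot a s permutes {1..n}"
      using assms by (elim permutes_subset) auto
    then show "bij_betw (\<lambda>p. p \<circ> rot a s) ?P ?P"
      using bij_betw_permutation_comp[OF permutes_id] by simp
  next
    fix p assume "p \<in> ?P"
    then have "inj_on p {a..a + 2}" using permutes_inj_on by blast
    then show "\<exists>!s. s \<in> {..<3} \<and> peak_at a (p \<circ> rot a s)"
      using ex1_rot_peak_at by simp
  qed (simp_all add: finite_permutations)
  moreover have "card ?P = fact n" by (rule card_permutations) simp_all
  ultimately show ?thesis by simp
qed

lemma card_peak_inv:
  assumes "1 \<le> b" "b + 2 \<le> n"
  shows "3 * card {p. p permutes {1..n} \<and> peak_at b (inv p)} = fact n"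
proof -
  have "bij_betw inv {p. p permutes {1..n}} {p. p permutes {1..n}}"
    by (rule bij_betw_byWitness[where f' = inv]) (auto simp: permutes_inv permutes_inv_inv)
  then have "bij_betw inv {p \<in> {p. p permutes {1..n}}. peak_at b (inv p)} {p \<in> {p. p permutes {1..n}}. peak_at b p}"
    by (rule bij_betw_Collect) simp
  then have "card {p. p permutes {1..n} \<and> peak_at b (inv p)} = card {p. p permutes {1..n} \<and> peak_at b p}"
    using bij_betw_same_card by fastforce
  then show ?thesis using card_peak[OF assms] by simp
qed

section \<open>The covariance\<close>

lemma pk_eq_sum: "real (pk n p) = (\<Sum>a\<in>{1..n - 2}. of_bool (peak_at a p))"
proof -
  have "peaks n p = Suc ` ({1..n - 2} \<inter> {a. peak_at a p})"
  proof (intro set_eqI iffI)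
    fix i assume "i \<in> peaks n p"
    then have "i = Suc (i - 1)" "i - 1 \<in> {1..n - 2} \<inter> {a. peak_at a p}"
      by (auto simp: peaks_def peak_at_def)
    then show "i \<in> Suc ` ({1..n - 2} \<inter> {a. peak_at a p})" by blast
  next
    fix i assume "i \<in> Suc ` ({1..n - 2} \<inter> {a. peak_at a p})"
    then show "i \<in> peaks n p" by (auto simp: peaks_def peak_at_def)
  qed
  then have "pk n p = card ({1..n - 2} \<inter> {a. peak_at a p})"
    by (simp add: pk_def card_image)
  then show ?thesis by simp
qed

lemma sum_of_bool_permutes:
  assumes "finite S"
  shows "(\<Sum>p | p permutes S. of_bool (R p)) = real (card {p. p permutes S \<and> R p})"
  unfolding Collect_conj_eq using finite_permutations[OF assms]
  by (intro sum_of_bool_eq)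

lemma sum_pk:
  "(\<Sum>p | p permutes {1..n}. real (pk n p)) = real (n - 2) * fact n / 3"
  "(\<Sum>p | p permutes {1..n}. real (pk n (inv p))) = real (n - 2) * fact n / 3"
proof -
  let ?P = "{p. p permutes {1..n}}"
  have one: "(\<Sum>p\<in>?P. of_bool (peak_at a p)) = (fact n / 3 :: real)"
            "(\<Sum>p\<in>?P. of_bool (peak_at a (inv p))) = (fact n / 3 :: real)" if "a \<in> {1..n - 2}" for a
  proof -
    have a: "1 \<le> a" "a + 2 \<le> n" using that by auto
    have "real (3 * card {p. p permutes {1..n} \<and> peak_at a p}) = fact n"
         "real (3 * card {p. p permutes {1..n} \<and> peak_at a (inv p)}) = fact n"
      by (simp_all only: card_peak[OF a] card_peak_inv[OF a] of_nat_fact)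
    then show "(\<Sum>p\<in>?P. of_bool (peak_at a p)) = (fact n / 3 :: real)"
              "(\<Sum>p\<in>?P. of_bool (peak_at a (inv p))) = (fact n / 3 :: real)"
      unfolding sum_of_bool_permutes[OF finite_atLeastAtMost] by linarith+
  qed
  have "(\<Sum>p\<in>?P. real (pk n p)) = (\<Sum>a\<in>{1..n - 2}. \<Sum>p\<in>?P. of_bool (peak_at a p))"
    unfolding pk_eq_sum by (rule sum.swap)
  also have "\<dots> = (\<Sum>a\<in>{1..n - 2}. fact n / 3)" by (rule sum.cong) (simp_all only: one)
  finally show "(\<Sum>p\<in>?P. real (pk n p)) = real (n - 2) * fact n / 3" by simp
  have "(\<Sum>p\<in>?P. real (pk n (inv p))) = (\<Sum>a\<in>{1..n - 2}. \<Sum>p\<in>?P. of_bool (peak_at a (inv p)))"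
    unfolding pk_eq_sum by (rule sum.swap)
  also have "\<dots> = (\<Sum>a\<in>{1..n - 2}. fact n / 3)" by (rule sum.cong) (simp_all only: one)
  finally show "(\<Sum>p\<in>?P. real (pk n (inv p))) = real (n - 2) * fact n / 3" by simp
qed

lemma sum_pk_mult_pk_inv:
  "(\<Sum>p | p permutes {1..n}. real (pk n p) * real (pk n (inv p)))
     = real (n - 2) ^ 2 * (fact n + 3 * fact (n - 3)) / 9"
proof -
  let ?P = "{p. p permutes {1..n}}"
  have one: "(\<Sum>p\<in>?P. of_bool (peak_at a p) * of_bool (peak_at b (inv p))) = ((fact n + 3 * fact (n - 3)) / 9 :: real)"
    if "a \<in> {1..n - 2}" "b \<in> {1..n - 2}" for a b
  proof -
    have ab: "1 \<le> a" "a + 2 \<le> n" "1 \<le> b" "b + 2 \<le> n" using that by auto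
    have "real (9 * card {p. p permutes {1..n} \<and> peak_at a p \<and> peak_at b (inv p)}) = fact n + 3 * fact (n - 3)"
      unfolding card_two_peaks[OF ab] by simp
    then show ?thesis
      unfolding of_bool_conj[symmetric] sum_of_bool_permutes[OF finite_atLeastAtMost]
      by (simp add: field_simps)
  qed
  have "(\<Sum>p\<in>?P. real (pk n p) * real (pk n (inv p)))
      = (\<Sum>p\<in>?P. \<Sum>a\<in>{1..n - 2}. \<Sum>b\<in>{1..n - 2}. of_bool (peak_at a p) * of_bool (peak_at b (inv p)))"
    unfolding pk_eq_sum by (simp only: sum_product)
  also have "\<dots> = (\<Sum>a\<in>{1..n - 2}. \<Sum>p\<in>?P. \<Sum>b\<in>{1..n - 2}. of_bool (peak_at a p) * of_bool (peak_at b (inv p)))"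
    by (rule sum.swap)
  also have "\<dots> = (\<Sum>a\<in>{1..n - 2}. \<Sum>b\<in>{1..n - 2}. \<Sum>p\<in>?P. of_bool (peak_at a p) * of_bool (peak_at b (inv p)))"
    by (rule sum.cong[OF refl], rule sum.swap)
  also have "\<dots> = (\<Sum>a\<in>{1..n - 2}. \<Sum>b\<in>{1..n - 2}. (fact n + 3 * fact (n - 3)) / 9)"
    by (intro sum.cong refl one)
  finally show ?thesis by (simp add: power2_eq_square)
qed

lemma covariance_pmf_of_set:
  assumes "finite P" "P \<noteq> {}"
  shows "covariance (measure_pmf (pmf_of_set P)) X Y
    = (\<Sum>p\<in>P. X p * Y p) / card P - (\<Sum>p\<in>P. X p) / card P * ((\<Sum>p\<in>P. Y p) / card P)"
proof -
  let ?x = "(\<Sum>p\<in>P. X p) / card P" and ?y = "(\<Sum>p\<in>P. Y p) / card P"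
  have c: "real (card P) \<noteq> 0" using assms by simp
  have "(\<Sum>p\<in>P. (X p - x) * (Y p - y))
      = (\<Sum>p\<in>P. X p * Y p) - (\<Sum>p\<in>P. X p) * y - x * (\<Sum>p\<in>P. Y p) + card P * (x * y)" for x y :: real
    by (simp add: left_diff_distrib right_diff_distrib sum_subtractf
        flip: sum_distrib_left sum_distrib_right)
  then have "(\<Sum>p\<in>P. (X p - ?x) * (Y p - ?y))
      = (\<Sum>p\<in>P. X p * Y p) - (\<Sum>p\<in>P. X p) * ?y - ?x * (\<Sum>p\<in>P. Y p) + card P * (?x * ?y)" .
  also have "\<dots> = (\<Sum>p\<in>P. X p * Y p) - card P * (?x * ?y)"
    using c by simp
  finally show ?thesis
    using assms c by (simp add: covariance_def integral_pmf_of_set diff_divide_distrib)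
qed

theorem proposition3p2:
  fixes n :: nat
  assumes "n \<ge> 2"
  shows "covariance (measure_pmf (uniform_perm n))
           (\<lambda>p. real (pk n p + 1)) (\<lambda>p. real (pk n (inv p) + 1))
         = (real n - 2) / (3 * real n * (real n - 1))"
proof -
  let ?P = "{p. p permutes {1..n}}"
  define m where "m = real (n - 2)"
  have m: "m = real n - 2" using assms by (simp add: m_def of_nat_diff)
  have fin: "finite ?P" by (simp add: finite_permutations)
  have ne: "?P \<noteq> {}" using permutes_id by blast
  have "card ?P = fact n" by (rule card_permutations) simp_all
  then have card: "real (card ?P) = fact n" by simp
  have "(\<Sum>p\<in>?P. real (pk n p + 1) * real (pk n (inv p) + 1))
      = (\<Sum>p\<in>?P. real (pk n p) * real (pk n (inv p))) + (\<Sum>p\<in>?P. real (pk n p))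
        + (\<Sum>p\<in>?P. real (pk n (inv p))) + real (card ?P)"
    by (simp add: algebra_simps sum.distrib)
  then have XY: "(\<Sum>p\<in>?P. real (pk n p + 1) * real (pk n (inv p) + 1))
      = m ^ 2 * (fact n + 3 * fact (n - 3)) / 9 + 2 * (m * fact n / 3) + fact n"
    unfolding sum_pk sum_pk_mult_pk_inv card m_def by linarith
  have X: "(\<Sum>p\<in>?P. real (pk n p + 1)) = m * fact n / 3 + fact n"
    using sum_pk(1)[of n] card by (simp add: m_def sum.distrib)
  have Y: "(\<Sum>p\<in>?P. real (pk n (inv p) + 1)) = m * fact n / 3 + fact n"
    using sum_pk(2)[of n] card by (simp add: m_def sum.distrib)
  have "covariance (measure_pmf (uniform_perm n)) (\<lambda>p. real (pk n p + 1)) (\<lambda>p. real (pk n (inv p) + 1))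
      = (m ^ 2 * (fact n + 3 * fact (n - 3)) / 9 + 2 * (m * fact n / 3) + fact n) / fact n
        - (m * fact n / 3 + fact n) / fact n * ((m * fact n / 3 + fact n) / fact n)"
    unfolding uniform_perm_def covariance_pmf_of_set[OF fin ne] XY X Y card ..
  also have "\<dots> = m ^ 2 * fact (n - 3) / (3 * fact n)"
    by (simp add: field_simps power2_eq_square)
  also have "\<dots> = m / (3 * real n * (real n - 1))"
    (* For n = 2 the truncated difference n - 3 does no harm, because then m = 0. *)
  proof (cases "n = 2")
    case True
    then show ?thesis by (simp add: m_def)
  next
    case False
    then have "n = (n - 3) + 3" using assms by simp
    then obtain k where k: "n = k + 3" by blast
    have "fact n = real n * (real n - 1) * m * fact (n - 3)"
      unfolding m by (simp add: k eval_nat_numeral algebra_simps)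
    moreover have "m > 0" "real n * (real n - 1) > 0" by (simp_all add: m k)
    ultimately show ?thesis by (simp add: power2_eq_square)
  qed
  finally show ?thesis by (simp add: m)
qed

end
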